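(* Let $m,n,d$ be positive integers and let $x\in(0,1]$ with $xn$ an integer. After all $m$ balls have been placed by $\mathrm{GREEDY}(m,n,d)$, the expected total number of balls in the $xn$ least-loaded bins is at most $x^d m$. Moreover, for every integer $k\ge 1$, the probability that the $xn$ least-loaded bins together contain at least $k$ balls is at most $$1-\sum_{i=0}^{k-1}\binom{m}{i}(1-x)^{m-i}x^{i}.$$
   Context: $\mathrm{GREEDY}(m,n,d)$ places $m$ balls into $n$ bins $B_1,\dots,B_n$ over time steps $t=1,\dots,m$. At each time step, $d$ indices are selected from $[n]=\{1,\dots,n\}$ independently and uniformly at random with replacement, forming a multiset $S_t$; the $t$-th ball is placed into a bin $B_M$ with $M\in S_t$ whose current load is maximal among the bins indexed by $S_t$; ties among maximal bins are broken uniformly at random. The load of a bin is the number of balls in it. "The number of balls in the $xn$ least-loaded bins" means the sum of the $xn$ smallest loads. *)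

theory Defs
  imports "HOL-Probability.Probability"
begin

text \<open>A configuration \<open>L :: nat \<Rightarrow> nat\<close> gives the load \<open>L b\<close> of each bin \<open>b \<in> {1..n}\<close>.\<close>

definition maximal_bins :: "(nat \<Rightarrow> nat) \<Rightarrow> nat set \<Rightarrow> nat set" where
  "maximal_bins L S = {b \<in> S. \<forall>c \<in> S. L c \<le> L b}"

text \<open>The \<open>d\<close> draws with replacement form a list \<open>bs\<close>.  Ties are broken uniformly among the
  distinct bins of maximal load in \<open>set bs\<close>; how often a bin was drawn does not matter.\<close>

definition greedy_step :: "nat \<Rightarrow> nat \<Rightarrow> (nat \<Rightarrow> nat) \<Rightarrow> (nat \<Rightarrow> nat) pmf" where
  "greedy_step n d L =
     do {
       bs \<leftarrow> replicate_pmf d (pmf_of_set {1..n});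
       b \<leftarrow> pmf_of_set (maximal_bins L (set bs));
       return_pmf (L(b := L b + 1))
     }"

primrec greedy :: "nat \<Rightarrow> nat \<Rightarrow> nat \<Rightarrow> (nat \<Rightarrow> nat) pmf" where
  "greedy 0 n d = return_pmf (\<lambda>_. 0)"
| "greedy (Suc m) n d = do { L \<leftarrow> greedy m n d; greedy_step n d L }"

definition least_loaded_balls :: "nat \<Rightarrow> nat \<Rightarrow> (nat \<Rightarrow> nat) \<Rightarrow> nat" where
  "least_loaded_balls n j L = sum_list (take j (sort (map L [1..<Suc n])))"

text \<open>Finite support: every expectation over \<open>greedy\<close> is a genuine finite sum, so the
  Bochner integral never takes its default value.\<close>

lemma finite_set_pmf_greedy:
  assumes "n > 0" "d > 0"
  shows "finite (set_pmf (greedy m n d))"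
proof (induction m)
  case 0
  then show ?case by simp
next
  case (Suc m)
  have "finite (set_pmf (greedy_step n d L))" for L
  proof -
    have S: "set_pmf (replicate_pmf d (pmf_of_set {1..n})) = {bs \<in> lists {1..n}. length bs = d}"
      using assms by (simp add: set_replicate_pmf)
    have fin: "finite {bs \<in> lists {1..n}. length bs = d}"
      using finite_lists_length_eq[of "{1..n}" d]
      by (rule rev_finite_subset) (auto simp: lists_eq_set)
    have "finite (set_pmf (pmf_of_set (maximal_bins L (set bs))))"
      if "bs \<in> {bs \<in> lists {1..n}. length bs = d}" for bs
    proof -
      have ne: "set bs \<noteq> {}" using that assms by auto
      have "Max (L ` set bs) \<in> L ` set bs" using ne by (intro Max_in) auto
      then obtain b where "b \<in> set bs" "L b = Max (L ` set bs)" by auto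
      then have "b \<in> maximal_bins L (set bs)"
        by (auto simp: maximal_bins_def)
      moreover have "finite (maximal_bins L (set bs))"
        by (auto simp: maximal_bins_def)
      ultimately show ?thesis by (metis empty_iff set_pmf_of_set)
    qed
    then show ?thesis
      unfolding greedy_step_def set_bind_pmf S using fin by (intro finite_UN_I) auto
  qed
  with Suc show ?case by simp
qed

end

theory Submission
  imports Defs
begin

text \<open>Let \<open>F L\<close> be the sum of the \<open>j\<close> smallest loads, i.e. the least total load of a \<open>j\<close>-element set
  of bins. Adding a ball to bin \<open>b\<close> raises \<open>F\<close> by at most one, and only if at most \<open>j\<close> bins have
  load \<open>\<le> L b\<close>: otherwise \<open>b\<close> can be exchanged for an equally good bin outside an optimal set.
  The bins with this property form a set \<open>A\<close> of at most \<open>j\<close> bins that is downward closed with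
  respect to the load. As the chosen bin has maximal load among the draws, it lies in \<open>A\<close> only if
  all \<open>d\<close> draws do, which has probability at most \<open>x ^ d\<close>. Summing over the time steps gives the
  expectation; and since \<open>x ^ d \<le> x\<close>, the tails of \<open>F\<close> are dominated, by induction on the number
  of balls, by those of a binomial variable with parameters \<open>m\<close> and \<open>x\<close>.\<close>

section \<open>The least-loaded bins\<close>

text \<open>Sorting bins instead of bare loads lets the \<open>j\<close> smallest loads be read as
  the loads of \<open>j\<close> actual bins.\<close>

lemma sort_map_eq_map_sort_key: "sort (map f xs) = map f (sort_key f xs)"
proof -
  have insort: "insort (f x) (map f ys) = map f (insort_key f x ys)" for x ys
    by (induction ys) auto
  show ?thesis
    by (induction xs) (auto simp: insort)
qed

text \<open>The common part \<open>S \<inter> T\<close> cancels. The two differences have equal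
  size, and the minimum \<open>v\<close> of \<open>f\<close> on \<open>T - S\<close> bounds
  \<open>f\<close> from above on \<open>S - T\<close>.\<close>

lemma sum_le_sum_if_card_eq:
  fixes f :: "'a \<Rightarrow> nat"
  assumes "finite S" "finite T" "card S = card T"
    and le: "\<And>s t. s \<in> S - T \<Longrightarrow> t \<in> T - S \<Longrightarrow> f s \<le> f t"
  shows "sum f S \<le> sum f T"
proof -
  have card: "card (S - T) = card (T - S)"
    using assms(1-3) by (metis Int_commute card_Diff_subset_Int finite_Int)
  have "sum f (S - T) \<le> sum f (T - S)"
  proof (cases "T - S = {}")
    case True
    then have "S - T = {}" using card assms(1) by (metis card_0_eq card.empty finite_Diff)
    then show ?thesis by (simp only: sum.empty le0)
  next
    case False
    define v where "v = Min (f ` (T - S))"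
    have v: "v \<in> f ` (T - S)" unfolding v_def using False assms(2) by (intro Min_in) auto
    have "sum f (S - T) \<le> card (S - T) * v"
      using sum_bounded_above[of "S - T" f v] v le by auto
    also have "\<dots> = card (T - S) * v" by (simp only: card)
    also have "\<dots> \<le> sum f (T - S)"
      using sum_bounded_below[of "T - S" v f] assms(2) by (auto simp: v_def)
    finally show ?thesis .
  qed
  moreover have "sum f S = sum f (S - T) + sum f (S \<inter> T)"
    using sum.Int_Diff[OF assms(1), of f T] by simp
  moreover have "sum f T = sum f (T - S) + sum f (S \<inter> T)"
    using sum.Int_Diff[OF assms(2), of f S] by (simp add: Int_commute)
  ultimately show ?thesis by simp
qed

text \<open>The witness consists of the first \<open>j\<close> bins in order of load; sortedness
  separates them from all the others.\<close>

lemma least_loaded_balls_attained: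
  assumes "j \<le> n"
  obtains S where "S \<subseteq> {1..n}" "card S = j" "least_loaded_balls n j L = sum L S"
    "\<And>s t. s \<in> S \<Longrightarrow> t \<in> {1..n} - S \<Longrightarrow> L s \<le> L t"
proof
  define ys where "ys = sort_key L [1..<Suc n]"
  have ys: "distinct ys" "set ys = {1..n}" "length ys = n" "sorted (map L ys)"
    by (auto simp: ys_def simp del: upt_Suc)
  show "set (take j ys) \<subseteq> {1..n}"
    using set_take_subset[of j ys] ys by auto
  show "card (set (take j ys)) = j"
    using ys assms by (simp add: distinct_card)
  show "least_loaded_balls n j L = sum L (set (take j ys))"
    using ys unfolding least_loaded_balls_def sort_map_eq_map_sort_key ys_def[symmetric] take_map
    by (simp add: sum_list_distinct_conv_sum_set)
  fix s t assume s: "s \<in> set (take j ys)" and t: "t \<in> {1..n} - set (take j ys)"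
  have "t \<in> set (drop j ys)"
    using t ys(2) by (metis DiffE Un_iff append_take_drop_id set_append)
  moreover have "sorted (map L (take j ys) @ map L (drop j ys))"
    using ys(4) by (metis append_take_drop_id map_append)
  ultimately show "L s \<le> L t"
    using s by (auto simp: sorted_append)
qed

text \<open>With the previous lemma this makes \<open>least_loaded_balls\<close> a minimum over
  \<open>j\<close>-element sets, so an upper bound after a move needs only one good candidate
  set.\<close>

lemma least_loaded_balls_le:
  assumes "T \<subseteq> {1..n}" "card T = j"
  shows "least_loaded_balls n j L \<le> sum L T"
proof -
  have "j \<le> n" using card_mono[OF _ assms(1)] assms(2) by simp
  then obtain S where "S \<subseteq> {1..n}" "card S = j" "least_loaded_balls n j L = sum L S"
    "\<And>s t. s \<in> S \<Longrightarrow> t \<in> {1..n} - S \<Longrightarrow> L s \<le> L t"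
    using least_loaded_balls_attained[of j n L] by metis
  then show ?thesis
    using assms by (auto intro!: sum_le_sum_if_card_eq intro: finite_subset)
qed

text \<open>Ties count against \<open>b\<close>: a load level that straddles position
  \<open>j\<close> is left out as a whole, since each of its bins has an equally light
  substitute.\<close>

definition low_bins :: "nat \<Rightarrow> nat \<Rightarrow> (nat \<Rightarrow> nat) \<Rightarrow> nat set" where
  "low_bins n j L = {b \<in> {1..n}. card {c \<in> {1..n}. L c \<le> L b} \<le> j}"

text \<open>All of \<open>low_bins\<close> lies below the load of its fullest member
  \<open>b\<close>, and membership of \<open>b\<close> bounds the number of such bins by
  \<open>j\<close>.\<close>

lemma card_low_bins_le: "card (low_bins n j L) \<le> j"
proof (cases "low_bins n j L = {}")
  case False
  have fin: "finite (low_bins n j L)" by (simp add: low_bins_def)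
  then have "Max (L ` low_bins n j L) \<in> L ` low_bins n j L"
    using False by (intro Max_in) auto
  then obtain b where b: "b \<in> low_bins n j L" "L b = Max (L ` low_bins n j L)" by auto
  have "low_bins n j L \<subseteq> {c \<in> {1..n}. L c \<le> L b}"
    using fin b(2) by (auto simp: low_bins_def)
  then have "card (low_bins n j L) \<le> card {c \<in> {1..n}. L c \<le> L b}"
    by (intro card_mono) auto
  also have "\<dots> \<le> j" using b(1) by (simp add: low_bins_def)
  finally show ?thesis .
qed simp

lemma low_bins_downward_closed:
  assumes "b \<in> low_bins n j L" "c \<in> {1..n}" "L c \<le> L b"
  shows "c \<in> low_bins n j L"
proof -
  have "card {a \<in> {1..n}. L a \<le> L c} \<le> card {a \<in> {1..n}. L a \<le> L b}"
    using assms(3) by (intro card_mono) auto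
  then show ?thesis using assms by (auto simp: low_bins_def)
qed

text \<open>A set that is optimal for the old loads remains a candidate for the new ones and gains
  at most one ball.\<close>

lemma least_loaded_balls_add_ball_le_Suc:
  assumes "j \<le> n"
  shows "least_loaded_balls n j (L(b := L b + 1)) \<le> Suc (least_loaded_balls n j L)"
proof -
  obtain S where S: "S \<subseteq> {1..n}" "card S = j" "least_loaded_balls n j L = sum L S"
    using least_loaded_balls_attained[OF assms] by metis
  have fin: "finite S" using S(1) finite_subset by blast
  have "least_loaded_balls n j (L(b := L b + 1)) \<le> sum (L(b := L b + 1)) S"
    using S by (intro least_loaded_balls_le)
  also have "\<dots> \<le> (\<Sum>c\<in>S. L c + (if b = c then 1 else 0))"
    by (intro sum_mono) auto
  also have "\<dots> \<le> Suc (sum L S)"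
    using fin by (simp add: sum.distrib)
  finally show ?thesis using S(3) by simp
qed

lemma least_loaded_balls_add_ball_le:
  assumes "j \<le> n" "b \<in> {1..n}" "b \<notin> low_bins n j L"
  shows "least_loaded_balls n j (L(b := L b + 1)) \<le> least_loaded_balls n j L"
proof -
  obtain S where S: "S \<subseteq> {1..n}" "card S = j" "least_loaded_balls n j L = sum L S"
    using least_loaded_balls_attained[OF assms(1)] by metis
  have fin: "finite S" using S(1) finite_subset by blast
  obtain T where T: "T \<subseteq> {1..n}" "card T = j" "b \<notin> T" "sum L T \<le> sum L S"
  proof (cases "b \<in> S")
    case False
    with S that show ?thesis by blast
  next
    case True
    \<comment> \<open>More than \<open>j\<close> bins are at most as full as \<open>b\<close>, so
      \<open>S\<close> misses one of them; that bin replaces \<open>b\<close>.\<close>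
    have "card {c \<in> {1..n}. L c \<le> L b} > card S"
      using assms S(2) by (auto simp: low_bins_def)
    then have "\<not> {c \<in> {1..n}. L c \<le> L b} \<subseteq> S"
      using card_mono[OF fin] by (metis not_le)
    then obtain c where c: "c \<in> {1..n}" "L c \<le> L b" "c \<notin> S" by auto
    show ?thesis
    proof (rule that)
      show "insert c (S - {b}) \<subseteq> {1..n}" using S c by auto
      show "card (insert c (S - {b})) = j"
        using fin c True S(2) by (metis DiffD1 card_Suc_Diff1 card_insert_disjoint finite_Diff)
      show "b \<notin> insert c (S - {b})" using True c by auto
      show "sum L (insert c (S - {b})) \<le> sum L S"
        using fin c True by (simp add: sum.remove)
    qed
  qed
  have "least_loaded_balls n j (L(b := L b + 1)) \<le> sum (L(b := L b + 1)) T"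
    using T by (intro least_loaded_balls_le)
  also have "\<dots> = sum L T"
    using T(3) by (intro sum.cong) auto
  finally show ?thesis using S(3) T(4) by simp
qed

section \<open>A single step\<close>

lemma prob_replicate_pmf_subset:
  fixes p :: "'a :: countable pmf"
  shows "measure_pmf.prob (replicate_pmf d p) {xs. set xs \<subseteq> A} = measure_pmf.prob p A ^ d"
proof (induction d)
  case 0
  then show ?case by simp
next
  case (Suc d)
  have "replicate_pmf (Suc d) p = map_pmf (\<lambda>(x, xs). x # xs) (pair_pmf p (replicate_pmf d p))"
    by (simp add: pair_pmf_def map_bind_pmf)
  moreover have "(\<lambda>(x, xs). x # xs) -` {xs. set xs \<subseteq> A} = A \<times> {xs. set xs \<subseteq> A}"
    by auto
  ultimately show ?case
    by (simp add: measure_pmf_prob_product Suc del: replicate_pmf.simps)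
qed

text \<open>If the final event forces the first stage into \<open>A\<close>, the second stage
  contributes at most the indicator of \<open>A\<close>. This lets the random tie-breaking be
  ignored below.\<close>

lemma prob_bind_pmf_le:
  assumes "\<And>x y. x \<in> set_pmf p \<Longrightarrow> y \<in> set_pmf (f x) \<Longrightarrow> y \<in> B \<Longrightarrow> x \<in> A"
  shows "measure_pmf.prob (bind_pmf p f) B \<le> measure_pmf.prob p A"
proof -
  have "emeasure (f x) B \<le> indicator A x" if "x \<in> set_pmf p" for x
  proof (cases "x \<in> A")
    case True
    then show ?thesis by (simp add: measure_pmf.emeasure_le_1)
  next
    case False
    then have "set_pmf (f x) \<inter> B = {}" using assms that by blast
    then have "emeasure (f x) B = 0"
      by (simp add: measure_pmf.emeasure_eq_measure measure_pmf_zero_iff)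
    then show ?thesis by simp
  qed
  then have "(\<integral>\<^sup>+x. emeasure (f x) B \<partial>p) \<le> (\<integral>\<^sup>+x. indicator A x \<partial>p)"
    by (intro nn_integral_mono_AE) (simp add: AE_measure_pmf_iff)
  then have "emeasure (bind_pmf p f) B \<le> emeasure p A"
    by simp
  then show ?thesis
    by (simp add: measure_pmf.emeasure_eq_measure)
qed

lemma set_pmf_of_set_maximal_bins:
  assumes "set bs \<noteq> {}"
  shows "set_pmf (pmf_of_set (maximal_bins L (set bs))) = maximal_bins L (set bs)"
proof (rule set_pmf_of_set)
  have "Max (L ` set bs) \<in> L ` set bs" using assms by (intro Max_in) auto
  then obtain b where "b \<in> set bs" "L b = Max (L ` set bs)" by auto
  then have "b \<in> maximal_bins L (set bs)" by (auto simp: maximal_bins_def)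
  then show "maximal_bins L (set bs) \<noteq> {}" by blast
  show "finite (maximal_bins L (set bs))" by (simp add: maximal_bins_def)
qed

lemma set_replicate_pmf_bins:
  fixes bs :: "nat list"
  assumes "n > 0" "d > 0" "bs \<in> set_pmf (replicate_pmf d (pmf_of_set {1..n}))"
  shows "set bs \<subseteq> {1..n}" "set bs \<noteq> {}"
proof -
  have "set_pmf (pmf_of_set {1..n}) = {1..n}"
    using assms(1) by (intro set_pmf_of_set) auto
  then show "set bs \<subseteq> {1..n}" "set bs \<noteq> {}"
    using assms(2,3) by (auto simp: set_replicate_pmf)
qed

lemma set_pmf_greedy_stepD:
  assumes "L' \<in> set_pmf (greedy_step n d L)"
  shows "\<exists>b. L' = L(b := L b + 1)"
  using assms unfolding greedy_step_def set_bind_pmf set_return_pmf by blast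

lemma prob_greedy_step_increase_le:
  assumes "n > 0" "d > 0" "j \<le> n"
  shows "measure_pmf.prob (greedy_step n d L)
           {L'. least_loaded_balls n j L < least_loaded_balls n j L'} \<le> (real j / real n) ^ d"
proof -
  let ?A = "low_bins n j L"
  have "measure_pmf.prob (greedy_step n d L)
          {L'. least_loaded_balls n j L < least_loaded_balls n j L'}
      \<le> measure_pmf.prob (replicate_pmf d (pmf_of_set {1..n})) {bs. set bs \<subseteq> ?A}"
    unfolding greedy_step_def
  proof (rule prob_bind_pmf_le)
    fix bs L'
    assume bs: "bs \<in> set_pmf (replicate_pmf d (pmf_of_set {1..n}))"
      and L': "L' \<in> set_pmf (pmf_of_set (maximal_bins L (set bs)) \<bind>
                 (\<lambda>b. return_pmf (L(b := L b + 1))))"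
        "L' \<in> {L'. least_loaded_balls n j L < least_loaded_balls n j L'}"
    note sub = set_replicate_pmf_bins[OF assms(1,2) bs]
    from L'(1) obtain b where b: "b \<in> maximal_bins L (set bs)" "L' = L(b := L b + 1)"
      by (auto simp: set_pmf_of_set_maximal_bins[OF sub(2)])
    have "b \<in> {1..n}" using b(1) sub(1) by (auto simp: maximal_bins_def)
    then have "b \<in> ?A"
      using least_loaded_balls_add_ball_le[OF assms(3), of b L] L'(2) b(2) by fastforce
    \<comment> \<open>No drawn bin is fuller than \<open>b\<close>, so downward closure puts every
      draw into \<open>?A\<close>.\<close>
    then show "bs \<in> {bs. set bs \<subseteq> ?A}"
      using b(1) sub(1) low_bins_downward_closed by (fastforce simp: maximal_bins_def)
  qed
  also have "\<dots> = measure_pmf.prob (pmf_of_set {1..n}) ?A ^ d"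
    by (rule prob_replicate_pmf_subset)
  also have "measure_pmf.prob (pmf_of_set {1..n}) ?A = real (card ?A) / real n"
    using assms(1) by (subst measure_pmf_of_set) (auto simp: low_bins_def intro!: arg_cong[where f = card])
  also have "(real (card ?A) / real n) ^ d \<le> (real j / real n) ^ d"
    by (intro power_mono divide_right_mono) (auto simp: card_low_bins_le)
  finally show ?thesis .
qed

section \<open>Iterating the process\<close>

lemma expectation_bind_pmf_finite:
  fixes h :: "'b \<Rightarrow> real"
  assumes "finite (set_pmf p)" "\<And>x. x \<in> set_pmf p \<Longrightarrow> finite (set_pmf (f x))"
  shows "measure_pmf.expectation (bind_pmf p f) h
       = measure_pmf.expectation p (\<lambda>x. measure_pmf.expectation (f x) h)"
  by (subst pmf_expectation_bind[of "set_pmf p"])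
     (use assms in \<open>auto simp: integral_measure_pmf[of "set_pmf p"]\<close>)

lemma finite_set_pmf_greedy_step:
  assumes "n > 0" "d > 0" "L \<in> set_pmf (greedy m n d)"
  shows "finite (set_pmf (greedy_step n d L))"
proof (rule finite_subset)
  \<comment> \<open>Since \<open>L\<close> is reachable, every outcome of a step from
    \<open>L\<close> lies in the finite support one time step later.\<close>
  show "set_pmf (greedy_step n d L) \<subseteq> set_pmf (greedy (Suc m) n d)"
    using assms(3) by auto
  show "finite (set_pmf (greedy (Suc m) n d))"
    by (rule finite_set_pmf_greedy[OF assms(1,2)])
qed

text \<open>This is the shared induction step of both bounds: \<open>c L\<close> is what an increase
  of the least-loaded sum may add to \<open>h\<close>. The mean uses \<open>c L = 1\<close>, the
  tail the indicator of states one ball below the threshold.\<close>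

lemma expectation_greedy_Suc_le:
  fixes h g :: "(nat \<Rightarrow> nat) \<Rightarrow> real"
  assumes "n > 0" "d > 0" "j \<le> n"
    and le: "\<And>L L'. least_loaded_balls n j L' \<le> Suc (least_loaded_balls n j L) \<Longrightarrow>
      h L' \<le> g L + c L * indicator {L'. least_loaded_balls n j L < least_loaded_balls n j L'} L'"
    and c: "\<And>L. c L \<ge> 0"
  shows "measure_pmf.expectation (greedy (Suc m) n d) h
       \<le> measure_pmf.expectation (greedy m n d) (\<lambda>L. g L + c L * (real j / real n) ^ d)"
proof -
  let ?I = "\<lambda>L. {L'. least_loaded_balls n j L < least_loaded_balls n j L'}"
  have fin: "finite (set_pmf (greedy m n d))" by (rule finite_set_pmf_greedy[OF assms(1,2)])
  have "measure_pmf.expectation (greedy (Suc m) n d) h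
      = measure_pmf.expectation (greedy m n d) (\<lambda>L. measure_pmf.expectation (greedy_step n d L) h)"
    using finite_set_pmf_greedy_step[OF assms(1,2)]
    by (simp add: expectation_bind_pmf_finite[OF fin])
  also have "\<dots> \<le> measure_pmf.expectation (greedy m n d) (\<lambda>L. g L + c L * (real j / real n) ^ d)"
  proof (intro integral_mono_AE integrable_measure_pmf_finite fin, unfold AE_measure_pmf_iff, rule ballI)
    fix L assume "L \<in> set_pmf (greedy m n d)"
    then have finL: "finite (set_pmf (greedy_step n d L))"
      by (rule finite_set_pmf_greedy_step[OF assms(1,2)])
    have "measure_pmf.expectation (greedy_step n d L) h
        \<le> measure_pmf.expectation (greedy_step n d L) (\<lambda>L'. g L + c L * indicator (?I L) L')"
    proof (intro integral_mono_AE integrable_measure_pmf_finite finL, unfold AE_measure_pmf_iff, rule ballI)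
      fix L' assume "L' \<in> set_pmf (greedy_step n d L)"
      then show "h L' \<le> g L + c L * indicator (?I L) L'"
        using set_pmf_greedy_stepD least_loaded_balls_add_ball_le_Suc[OF assms(3)]
        by (intro le) fastforce
    qed
    also have "\<dots> = g L + c L * measure_pmf.prob (greedy_step n d L) (?I L)"
      by (subst Bochner_Integration.integral_add)
         (auto intro!: integrable_measure_pmf_finite finL)
    also have "\<dots> \<le> g L + c L * (real j / real n) ^ d"
      using prob_greedy_step_increase_le[OF assms(1-3)] c by (intro add_left_mono mult_left_mono)
    finally show "measure_pmf.expectation (greedy_step n d L) h \<le> g L + c L * (real j / real n) ^ d" .
  qed
  finally show ?thesis .
qed

lemma least_loaded_balls_zero: "least_loaded_balls n j (\<lambda>_. 0) = 0"
proof -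
  have "set (take j (sort (map (\<lambda>_. 0 :: nat) [1..<Suc n]))) \<subseteq> {0}"
    using set_take_subset[of j "sort (map (\<lambda>_. 0 :: nat) [1..<Suc n])"] by auto
  then show ?thesis unfolding least_loaded_balls_def by (auto simp del: upt_Suc)
qed

lemma expectation_least_loaded_balls_le:
  assumes "n > 0" "d > 0" "j \<le> n"
  shows "measure_pmf.expectation (greedy m n d) (\<lambda>L. real (least_loaded_balls n j L))
       \<le> (real j / real n) ^ d * real m"
proof (induction m)
  case 0
  then show ?case by (simp add: least_loaded_balls_zero)
next
  case (Suc m)
  let ?q = "(real j / real n) ^ d"
  have "measure_pmf.expectation (greedy (Suc m) n d) (\<lambda>L. real (least_loaded_balls n j L))
      \<le> measure_pmf.expectation (greedy m n d) (\<lambda>L. real (least_loaded_balls n j L) + 1 * ?q)"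
    by (rule expectation_greedy_Suc_le[OF assms]) (auto simp: indicator_def)
  also have "\<dots> = measure_pmf.expectation (greedy m n d) (\<lambda>L. real (least_loaded_balls n j L)) + ?q"
    by (subst Bochner_Integration.integral_add)
       (auto intro!: integrable_measure_pmf_finite finite_set_pmf_greedy assms)
  finally show ?case using Suc by (simp add: algebra_simps)
qed

section \<open>Comparison with binomial tails\<close>

definition binomial_tail :: "real \<Rightarrow> nat \<Rightarrow> nat \<Rightarrow> real" where
  "binomial_tail x m k = 1 - (\<Sum>i<k. real (m choose i) * (1 - x) ^ (m - i) * x ^ i)"

text \<open>For \<open>x\<close> in the unit interval this conditions on one trial: a success leaves
  \<open>k\<close> to find, a failure \<open>Suc k\<close>. Algebraically it is Pascal's rule
  applied termwise, valid for every real \<open>x\<close>.\<close>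

lemma binomial_tail_Suc_Suc:
  "binomial_tail x (Suc m) (Suc k) = x * binomial_tail x m k + (1 - x) * binomial_tail x m (Suc k)"
proof -
  define b where "b m i = real (m choose i) * (1 - x) ^ (m - i) * x ^ i" for m i
  have b0: "b (Suc m) 0 = (1 - x) * b m 0" by (simp add: b_def)
  have bS: "b (Suc m) (Suc i) = x * b m i + (1 - x) * b m (Suc i)" for i
  proof (cases "Suc i \<le> m")
    case True
    then have "(1 - x) ^ (m - i) = (1 - x) * (1 - x) ^ (m - Suc i)"
      by (metis Suc_diff_Suc Suc_le_lessD power_Suc)
    then show ?thesis by (simp add: b_def distrib_right distrib_left mult_ac)
  next
    \<comment> \<open>Here \<open>m - Suc i\<close> is truncated and the power no longer splits, but
      the coefficient \<open>m choose Suc i\<close> vanishes.\<close>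
    case False
    then have "m choose Suc i = 0" "m - i = 0" by (simp_all add: binomial_eq_0)
    then show ?thesis by (simp add: b_def del: binomial_eq_0_iff)
  qed
  have "(\<Sum>i<Suc k. b (Suc m) i) = x * (\<Sum>i<k. b m i) + (1 - x) * (\<Sum>i<Suc k. b m i)"
    unfolding sum.lessThan_Suc_shift[of _ k] b0 bS
    by (simp only: sum.distrib distrib_left sum_distrib_left[symmetric] add_ac)
  then show ?thesis
    unfolding binomial_tail_def b_def[symmetric] by (simp only:) (simp add: algebra_simps)
qed

lemma prob_least_loaded_balls_ge_le:
  assumes "n > 0" "d > 0" "j \<le> n"
  shows "measure_pmf.prob (greedy m n d) {L. k \<le> least_loaded_balls n j L}
       \<le> binomial_tail (real j / real n) m k"
proof (induction m arbitrary: k)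
  case 0
  show ?case
  proof (cases k)
    case (Suc l)
    \<comment> \<open>Without balls only the term \<open>i = 0\<close> survives, so the tail is zero
      for positive \<open>k\<close>.\<close>
    then have "(\<Sum>i<k. real (0 choose i) * (1 - real j / real n) ^ (0 - i) * (real j / real n) ^ i) = 1"
      by (simp add: sum.lessThan_Suc_shift del: sum.lessThan_Suc)
    then show ?thesis
      using Suc by (simp add: binomial_tail_def least_loaded_balls_zero)
  qed (simp add: binomial_tail_def)
next
  case (Suc m)
  define x where "x = real j / real n"
  have x: "0 \<le> x" "x \<le> 1" using assms by (auto simp: x_def)
  show ?case
  proof (cases k)
    case 0
    then show ?thesis by (simp add: binomial_tail_def)
  next
    case (Suc l)
    let ?F = "least_loaded_balls n j" and ?M = "greedy m n d"
    define E where "E k = {L. k \<le> ?F L}" for k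
    have mono: "indicator (E (Suc l)) L \<le> (indicator (E l) L :: real)" for L
      by (auto simp: E_def indicator_def)
    have "measure_pmf.prob (greedy (Suc m) n d) (E (Suc l))
        = measure_pmf.expectation (greedy (Suc m) n d) (indicator (E (Suc l)))"
      by simp
    \<comment> \<open>The difference of indicators singles out \<open>?F L = l\<close>, the only
      states from which one more ball reaches \<open>Suc l\<close>.\<close>
    also have "\<dots> \<le> measure_pmf.expectation ?M
        (\<lambda>L. indicator (E (Suc l)) L + (indicator (E l) L - indicator (E (Suc l)) L) * x ^ d)"
      unfolding x_def
      by (rule expectation_greedy_Suc_le[OF assms]) (use mono in \<open>auto simp: E_def indicator_def\<close>)
    also have "\<dots> = measure_pmf.prob ?M (E (Suc l))
        + (measure_pmf.prob ?M (E l) - measure_pmf.prob ?M (E (Suc l))) * x ^ d"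
      by (simp add: Bochner_Integration.integral_add Bochner_Integration.integral_diff
            integrable_measure_pmf_finite finite_set_pmf_greedy assms)
    also have "\<dots> \<le> measure_pmf.prob ?M (E (Suc l))
        + (measure_pmf.prob ?M (E l) - measure_pmf.prob ?M (E (Suc l))) * x"
    proof (intro add_left_mono mult_left_mono)
      show "x ^ d \<le> x" using x assms(2) power_decreasing[of 1 d x] by simp
      have "E (Suc l) \<subseteq> E l" by (auto simp: E_def)
      then show "0 \<le> measure_pmf.prob ?M (E l) - measure_pmf.prob ?M (E (Suc l))"
        by (simp add: measure_pmf.finite_measure_mono)
    qed
    \<comment> \<open>With \<open>x ^ d\<close> weakened to \<open>x\<close>, the bound is a convex
      combination, so the induction hypothesis applies at both \<open>l\<close> and
      \<open>Suc l\<close>.\<close>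
    also have "\<dots> = x * measure_pmf.prob ?M (E l) + (1 - x) * measure_pmf.prob ?M (E (Suc l))"
      by (simp add: algebra_simps)
    also have "\<dots> \<le> x * binomial_tail x m l + (1 - x) * binomial_tail x m (Suc l)"
      using Suc.IH x unfolding E_def x_def by (intro add_mono mult_left_mono) auto
    finally show ?thesis
      using Suc by (simp add: E_def x_def binomial_tail_Suc_Suc)
  qed
qed

theorem theorem4p1:
  fixes m n d j :: nat and x :: real
  assumes "m > 0" and "n > 0" and "d > 0"
    and "0 < x" and "x \<le> 1"
    and "x * real n = real j"
  shows "measure_pmf.expectation (greedy m n d) (\<lambda>L. real (least_loaded_balls n j L))
           \<le> x ^ d * real m
       \<and> (\<forall>k\<ge>1. measure_pmf.prob (greedy m n d) {L. k \<le> least_loaded_balls n j L}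
           \<le> 1 - (\<Sum>i = 0..k - 1. real (m choose i) * (1 - x) ^ (m - i) * x ^ i))"
proof -
  have x: "x = real j / real n"
    using assms(2,6) by (simp add: field_simps)
  have "real j \<le> real n"
    using assms(5,6) mult_right_mono[of x 1 "real n"] by simp
  then have j: "j \<le> n" by simp
  have "{0..k - 1} = {..<k}" if "k \<ge> 1" for k :: nat
    using that by auto
  then show ?thesis
    using expectation_least_loaded_balls_le[OF assms(2,3) j, of m]
      prob_least_loaded_balls_ge_le[OF assms(2,3) j, of m]
    by (simp add: x binomial_tail_def)
qed

end
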